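(* Let $0<p\le 1$ and $s>1$, let $X$ be a real reflexive Banach space, and let $\mathcal E:X\to\mathbb R$ be Fréchet differentiable and satisfy: (A) for each bounded set $K\subset X$ there is $\mathcal L_K>0$ such that $\|\mathcal E'(u)-\mathcal E'(w)\|_*\le\mathcal L_K\|u-w\|^p$ for all $u,w\in K$; (B) there exists $a>0$ such that $\langle\mathcal E'(x)-\mathcal E'(y),x-y\rangle\ge a\|x-y\|^s$ for all $x,y\in X$. Let $\mathcal D\subset X$ be a radial dictionary such that $\mathcal K:=\mathcal D\cap S_X$ is norming for $X^*$. Let $u^*$ be the unique minimizer of $\mathcal E$ on $X$. Then every greedy sequence $(u_m)_{m\in\mathbb N_0}$ generated by an $\mathcal E$-dictionary optimization over $\mathcal D$ satisfies: (i) If $s>p+1$, then $\mathcal E(u_m)-\mathcal E(u^* )=O\bigl(m^{-\frac{p}{s-1-p}}\bigr)$ as $m\to\infty$. (ii) If $s=p+1$, then for every fixed $k\in\mathbb N$, $\mathcal E(u_m)-\mathcal E(u^* )=O(m^{-k})$ as $m\to\infty$, and, moreover, there exist constants $C>0$ and $\alpha\in[0,1)$ such that $$\mathcal E(u_m)-\mathcal E(u^* )\le C\,\alpha^m\qquad\text{for all }m\in\mathbb N_0.$$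
   Context: $S_X=\{x\in X:\|x\|=1\}$; $\|\cdot\|_*$ is the norm of the dual space $X^*$ and $\langle\cdot,\cdot\rangle$ the duality pairing. A set $C\subset X$ is a cone if $\lambda x\in C$ for all $x\in C$, $\lambda\ge 0$; it is balanced if $C=-C$. A radial dictionary is a weakly closed (possibly non-convex) balanced cone $\mathcal D\subset X$. A bounded set $\mathcal K\subset X$ is norming for $X^*$ if there is $C_{\mathcal K}>0$ with $\|\phi\|_*\le C_{\mathcal K}\sup_{z\in\mathcal K}|\langle\phi,z\rangle|$ for all $\phi\in X^*$. A greedy sequence generated by an $\mathcal E$-dictionary optimization over $\mathcal D$ is a sequence $(u_m)_{m\in\mathbb N_0}$ in $X$ with $u_0=0$ such that, for every $m\ge 1$, $u_m-u_{m-1}\in\mathcal D$ and $\mathcal E(u_m)=\min_{v\in\mathcal D}\mathcal E(u_{m-1}+v)$. Under the stated assumptions $\mathcal E$ has a unique minimizer $u^*$ on $X$. *)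

theory Defs
  imports "HOL-Analysis.Analysis" "HOL-Library.Landau_Symbols"
begin

text \<open>
  The topological dual of \<open>'a\<close> is the type \<open>'a \<Rightarrow>\<^sub>L real\<close> of bounded linear functionals, whose
  \<open>norm\<close> is the dual norm; the duality pairing is \<open>blinfun_apply\<close>.
\<close>

definition reflexive_space :: "'a::real_normed_vector itself \<Rightarrow> bool" where
  "reflexive_space _ \<longleftrightarrow>
     (\<forall>F :: ('a \<Rightarrow>\<^sub>L real) \<Rightarrow>\<^sub>L real. \<exists>x::'a. \<forall>\<phi>. blinfun_apply F \<phi> = blinfun_apply \<phi> x)"

definition weak_topology :: "'a::real_normed_vector topology" where
  "weak_topology = topology_generated_by
     {blinfun_apply \<phi> -` U | (\<phi> :: 'a \<Rightarrow>\<^sub>L real) U. open U}"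

definition balanced :: "'a::real_vector set \<Rightarrow> bool" where
  "balanced C \<longleftrightarrow> C = uminus ` C"

definition radial_dictionary :: "'a::real_normed_vector set \<Rightarrow> bool" where
  "radial_dictionary D \<longleftrightarrow> closedin weak_topology D \<and> balanced D \<and> cone D"

text \<open>
  The supremum is taken in \<open>ennreal\<close> so that its value on the empty set is \<open>0\<close>; the supremum of
  the empty set in \<open>real\<close> is unspecified.
\<close>

definition norming :: "'a::real_normed_vector set \<Rightarrow> bool" where
  "norming K \<longleftrightarrow> bounded K \<and>
     (\<exists>C>0. \<forall>\<phi> :: 'a \<Rightarrow>\<^sub>L real.
        ennreal (norm \<phi>) \<le> ennreal C * (SUP z\<in>K. ennreal \<bar>blinfun_apply \<phi> z\<bar>))"

text \<open>
  The minimum over the dictionary is attained at the increment \<open>u m - u (m - 1)\<close>.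
\<close>

definition greedy_sequence ::
    "('a::real_normed_vector \<Rightarrow> real) \<Rightarrow> 'a set \<Rightarrow> (nat \<Rightarrow> 'a) \<Rightarrow> bool" where
  "greedy_sequence E D u \<longleftrightarrow> u 0 = 0 \<and>
     (\<forall>m\<ge>1. u m - u (m - 1) \<in> D \<and> (\<forall>v\<in>D. E (u m) \<le> E (u (m - 1) + v)))"

definition is_unique_minimizer :: "('a \<Rightarrow> real) \<Rightarrow> 'a \<Rightarrow> bool" where
  "is_unique_minimizer E x \<longleftrightarrow> (\<forall>y. E x \<le> E y) \<and> (\<forall>y. (\<forall>z. E y \<le> E z) \<longrightarrow> y = x)"

end

theory Submission
  imports Defs "HOL-Real_Asymp.Real_Asymp"
begin

text \<open>
  Write \<open>r m = E (u m) - E ustar\<close> and \<open>G = norm (E' (u m))\<close>. Strong monotonicity (B) gives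
  \<open>G \<ge> c * r m powr ((s - 1) / s)\<close>. By (A), a step of length proportional to \<open>G powr (1 / p)\<close> along
  a normalised dictionary element that almost norms \<open>E' (u m)\<close> lowers the energy by at least a
  multiple of \<open>G powr (1 + 1 / p)\<close>, and the greedy step does at least as well. Hence
  \<open>r (m + 1) \<le> r m - \<kappa> * r m powr (1 + \<gamma>)\<close> with \<open>\<gamma> = (s - 1 - p) / (s * p)\<close>, which yields
  geometric decay for \<open>\<gamma> = 0\<close> and \<open>r m = O(m powr (- 1 / \<gamma>))\<close> for \<open>\<gamma> > 0\<close>. The latter is better
  than the claimed rate by a factor \<open>s\<close> in the exponent.
\<close>

section \<open>Decay rates from scalar recursions\<close>

lemma power_recursion_decay:
  fixes r :: "nat \<Rightarrow> real"
  assumes nonneg: "\<And>m. 0 \<le> r m" and "0 < \<kappa>" and "0 < \<gamma>"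
    and rec: "\<And>m. r (Suc m) \<le> r m - \<kappa> * r m powr (1 + \<gamma>)"
  shows "r \<in> O(\<lambda>m. real m powr (- 1 / \<gamma>))"
proof -
  \<comment> \<open>The transform \<open>r m powr (-\<gamma>)\<close> linearises the recursion: it
    grows by at least \<open>\<gamma> * \<kappa>\<close> per step. A vanishing \<open>r m\<close> is
    excluded because \<open>0 powr (-\<gamma>)\<close> is 0; since \<open>r\<close> never increases,
    positivity passes to all earlier indices.\<close>
  have key: "real m * (\<gamma> * \<kappa>) \<le> r m powr (-\<gamma>)" if "0 < r m" for m
    using that
  proof (induction m)
    case (Suc m)
    have "r (Suc m) \<le> r m"
      using rec[of m] \<open>0 < \<kappa>\<close> by (smt (verit) mult_nonneg_nonneg powr_ge_zero)
    with Suc.prems have pos: "0 < r m" by linarith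
    define x where "x = \<kappa> * r m powr \<gamma>"
    have le: "r (Suc m) \<le> r m * (1 - x)"
      using rec[of m] pos by (simp add: x_def powr_add algebra_simps)
    have "0 < r m * (1 - x)" using le Suc.prems by linarith
    with pos have x1: "0 < 1 - x" by (simp add: zero_less_mult_iff)
    \<comment> \<open>Bernoulli's inequality for a negative exponent, (1 - x)^(-\<gamma>) \<ge> 1 +
      \<gamma> x, obtained by exponentiating this logarithmic bound.\<close>
    have "ln (1 - x) \<le> - x" using ln_le_minus_one[OF x1] by simp
    then have "\<gamma> * x \<le> - \<gamma> * ln (1 - x)" using \<open>0 < \<gamma>\<close> mult_left_mono[of "ln (1 - x)" "- x" \<gamma>] by simp
    then have "1 + \<gamma> * x \<le> (1 - x) powr (-\<gamma>)"
      using exp_ge_add_one_self[of "- \<gamma> * ln (1 - x)"] x1 by (simp add: powr_def)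
    then have "r m powr (-\<gamma>) * (1 + \<gamma> * x) \<le> r m powr (-\<gamma>) * (1 - x) powr (-\<gamma>)"
      by (intro mult_left_mono) auto
    also have "\<dots> = (r m * (1 - x)) powr (-\<gamma>)" using pos x1 by (simp add: powr_mult)
    also have "\<dots> \<le> r (Suc m) powr (-\<gamma>)"
      using \<open>0 < \<gamma>\<close> Suc.prems le by (intro powr_mono2') auto
    finally have "r m powr (-\<gamma>) + \<gamma> * \<kappa> \<le> r (Suc m) powr (-\<gamma>)"
      using pos by (simp add: x_def powr_minus field_simps)
    with Suc.IH[OF pos] show ?case by (simp add: algebra_simps)
  qed simp
  have "norm (r m) \<le> (\<gamma> * \<kappa>) powr (- 1 / \<gamma>) * norm (real m powr (- 1 / \<gamma>))" if "m \<ge> 1" for m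
  proof (cases "r m = 0")
    case False
    with nonneg[of m] have pos: "0 < r m" by simp
    have "r m = (r m powr (-\<gamma>)) powr (- 1 / \<gamma>)"
      using pos \<open>0 < \<gamma>\<close> by (simp add: powr_powr)
    also have "\<dots> \<le> (real m * (\<gamma> * \<kappa>)) powr (- 1 / \<gamma>)"
      using key[OF pos] \<open>0 < \<gamma>\<close> \<open>0 < \<kappa>\<close> that by (intro powr_mono2') auto
    also have "\<dots> = (\<gamma> * \<kappa>) powr (- 1 / \<gamma>) * real m powr (- 1 / \<gamma>)"
      using \<open>0 < \<gamma>\<close> \<open>0 < \<kappa>\<close> by (simp add: powr_mult)
    finally show ?thesis using pos by simp
  qed simp
  then show ?thesis
    by (intro bigoI[where c = "(\<gamma> * \<kappa>) powr (- 1 / \<gamma>)"] eventually_sequentiallyI[of 1])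
qed

lemma geometric_bound_bigo_powr:
  fixes r :: "nat \<Rightarrow> real"
  assumes "\<And>m. 0 \<le> r m" and "\<And>m. r m \<le> C * \<alpha> ^ m" and "0 < C" and "0 < \<alpha>" and "\<alpha> < 1"
  shows "r \<in> O(\<lambda>m. real m powr (- real k))"
proof -
  have "r \<in> O(\<lambda>m. \<alpha> ^ m)"
    using assms by (intro bigoI[where c = C]) auto
  also have "(\<lambda>m. \<alpha> ^ m) \<in> O(\<lambda>m. real m powr (- real k))"
    using \<open>0 < \<alpha>\<close> \<open>\<alpha> < 1\<close> by real_asymp
  finally show ?thesis .
qed

section \<open>Uniform convexity and smoothness of the energy\<close>

lemma blinfun_mvt:
  fixes E :: "'a::real_normed_vector \<Rightarrow> real" and E' :: "'a \<Rightarrow> ('a \<Rightarrow>\<^sub>L real)"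
  assumes deriv: "\<And>x. (E has_derivative blinfun_apply (E' x)) (at x)"
  obtains \<xi> where "0 < \<xi>" "\<xi> < 1" "E (x + h) - E x = blinfun_apply (E' (x + \<xi> *\<^sub>R h)) h"
proof -
  have "((\<lambda>t. E (x + t *\<^sub>R h)) has_real_derivative blinfun_apply (E' (x + t *\<^sub>R h)) h) (at t)" for t
  proof -
    have "((\<lambda>t. x + t *\<^sub>R h) has_derivative (\<lambda>d. d *\<^sub>R h)) (at t)"
      by (auto intro!: derivative_eq_intros)
    from has_derivative_compose[OF this deriv] show ?thesis
      by (simp add: has_field_derivative_def blinfun.scaleR_right mult_commute_abs)
  qed
  from MVT2[OF zero_less_one this] that show thesis by auto
qed

text \<open>The divisor \<open>2 powr s\<close> arises because (B) contributes quantitatively only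
  between \<open>x\<close> and the midpoint; integration would give a / s instead. Any positive
  constant suffices for the rates.\<close>

lemma strongly_monotone_lower_bound:
  fixes E :: "'a::real_normed_vector \<Rightarrow> real" and E' :: "'a \<Rightarrow> ('a \<Rightarrow>\<^sub>L real)"
  assumes deriv: "\<And>x. (E has_derivative blinfun_apply (E' x)) (at x)"
    and mono: "\<And>x y. blinfun_apply (E' x - E' y) (x - y) \<ge> a * norm (x - y) powr s" and "0 \<le> a"
  shows "E y \<ge> E x + blinfun_apply (E' x) (y - x) + a / 2 powr s * norm (y - x) powr s"
proof -
  have convex: "E (x + h) \<ge> E x + blinfun_apply (E' x) h" for x h
  proof -
    obtain \<xi> where \<xi>: "0 < \<xi>" "E (x + h) - E x = blinfun_apply (E' (x + \<xi> *\<^sub>R h)) h"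
      using blinfun_mvt[OF deriv] by metis
    \<comment> \<open>(B) is applied to the displacement \<open>\<xi> *\<^sub>R h\<close>; dividing
      by \<open>\<xi> > 0\<close> compares the derivatives in direction \<open>h\<close>.\<close>
    have "0 \<le> a * norm (x + \<xi> *\<^sub>R h - x) powr s" using \<open>0 \<le> a\<close> by simp
    also have "\<dots> \<le> blinfun_apply (E' (x + \<xi> *\<^sub>R h) - E' x) (x + \<xi> *\<^sub>R h - x)" by (rule mono)
    finally show ?thesis using \<xi> by (simp add: blinfun.scaleR_right blinfun.diff_left zero_le_mult_iff)
  qed
  \<comment> \<open>Applying convexity on both halves of the segment from \<open>x\<close> to \<open>y\<close> avoids integrating (B).\<close>
  define h where "h = (1 / 2) *\<^sub>R (y - x)"
  have "h + h = y - x" by (simp add: h_def flip: scaleR_add_left)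
  then have y: "y = x + h + h" by (simp add: add.assoc)
  have "a / 2 powr s * norm (y - x) powr s = a * norm h powr s"
    by (simp add: h_def powr_mult powr_divide)
  also have "\<dots> \<le> blinfun_apply (E' (x + h) - E' x) h" using mono[of "x + h" x] by simp
  finally show ?thesis
    using convex[of x h] convex[of "x + h" h]
    by (simp add: y blinfun.add_right blinfun.diff_left)
qed

text \<open>The mean value theorem replaces the usual integral, giving \<open>L\<close> where
  integration would give L / (1 + p). The Hoelder bound is needed only between \<open>x\<close> and
  points of the segment.\<close>

lemma holder_gradient_upper_bound:
  fixes E :: "'a::real_normed_vector \<Rightarrow> real" and E' :: "'a \<Rightarrow> ('a \<Rightarrow>\<^sub>L real)"
  assumes deriv: "\<And>x. (E has_derivative blinfun_apply (E' x)) (at x)"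
    and holder: "\<And>y. y \<in> closed_segment x (x + h) \<Longrightarrow> norm (E' y - E' x) \<le> L * norm (y - x) powr p"
    and "0 \<le> L" and "0 \<le> p"
  shows "E (x + h) \<le> E x + blinfun_apply (E' x) h + L * norm h powr (1 + p)"
proof -
  obtain \<xi> where \<xi>: "0 < \<xi>" "\<xi> < 1" "E (x + h) - E x = blinfun_apply (E' (x + \<xi> *\<^sub>R h)) h"
    using blinfun_mvt[OF deriv] by metis
  have "x + \<xi> *\<^sub>R h \<in> closed_segment x (x + h)"
    using \<xi> by (auto simp: in_segment algebra_simps intro!: exI[of _ \<xi>])
  from holder[OF this] have "norm (E' (x + \<xi> *\<^sub>R h) - E' x) \<le> L * norm (\<xi> *\<^sub>R h) powr p" by simp
  also have "\<dots> \<le> L * norm h powr p"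
    using \<xi> \<open>0 \<le> L\<close> \<open>0 \<le> p\<close> by (intro mult_left_mono powr_mono2) (auto simp: mult_left_le_one_le)
  finally have "norm (E' (x + \<xi> *\<^sub>R h) - E' x) * norm h \<le> L * norm h powr p * norm h"
    by (rule mult_right_mono) simp
  moreover have "blinfun_apply (E' (x + \<xi> *\<^sub>R h) - E' x) h \<le> norm (E' (x + \<xi> *\<^sub>R h) - E' x) * norm h"
    using norm_blinfun[of "E' (x + \<xi> *\<^sub>R h) - E' x" h] by simp
  moreover have "L * norm h powr p * norm h = L * norm h powr (1 + p)"
    by (cases "h = 0") (simp_all add: powr_add)
  ultimately have "blinfun_apply (E' (x + \<xi> *\<^sub>R h) - E' x) h \<le> L * norm h powr (1 + p)"
    by linarith
  with \<xi>(3) show ?thesis by (simp add: blinfun.diff_left)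
qed

lemma minimizer_gradient_zero:
  fixes E :: "'a::real_normed_vector \<Rightarrow> real"
  assumes "(E has_derivative blinfun_apply \<phi>) (at x)" and "\<And>y. E x \<le> E y"
  shows "\<phi> = 0"
proof -
  have "blinfun_apply \<phi> = (\<lambda>h. 0)"
    using assms by (intro has_derivative_local_min) auto
  then show ?thesis by (intro blinfun_eqI) simp
qed

text \<open>An inequality of Lojasiewicz type. With gap r and distance d to the minimizer, expanding
  at \<open>xmin\<close> gives c d^s \<le> r, and expanding at \<open>x\<close> gives r \<le>
  |E'(x)| d; eliminating d yields the claim.\<close>

lemma gap_le_gradient:
  fixes E :: "'a::real_normed_vector \<Rightarrow> real" and E' :: "'a \<Rightarrow> ('a \<Rightarrow>\<^sub>L real)"
  assumes low: "\<And>x y. E y \<ge> E x + blinfun_apply (E' x) (y - x) + c * norm (y - x) powr s"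
    and "0 < c" and "1 < s" and grad0: "E' xmin = 0" and min: "E xmin \<le> E x"
  shows "c powr (1 / s) * (E x - E xmin) powr ((s - 1) / s) \<le> norm (E' x)"
proof (cases "E x = E xmin")
  case False
  define r d where "r = E x - E xmin" and "d = norm (x - xmin)"
  have r: "0 < r" using False min by (simp add: r_def)
  have "c * d powr s \<le> r" using low[of xmin x] grad0 by (simp add: r_def d_def)
  then have "d powr s \<le> r / c" using \<open>0 < c\<close> by (simp add: field_simps)
  then have "(d powr s) powr (1 / s) \<le> (r / c) powr (1 / s)"
    using \<open>1 < s\<close> by (intro powr_mono2) auto
  then have d: "d \<le> r powr (1 / s) / c powr (1 / s)"
    using \<open>1 < s\<close> \<open>0 < c\<close> r by (simp add: powr_powr powr_divide d_def)
  have "r \<le> - blinfun_apply (E' x) (xmin - x)"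
    using low[of x xmin] \<open>0 < c\<close> by (smt (verit) mult_nonneg_nonneg powr_ge_zero r_def)
  also have "\<dots> \<le> norm (E' x) * d"
    using norm_blinfun[of "E' x" "xmin - x"] by (simp add: d_def norm_minus_commute)
  also have "\<dots> \<le> norm (E' x) * (r powr (1 / s) / c powr (1 / s))"
    by (intro mult_left_mono d) simp
  finally have "c powr (1 / s) * r \<le> norm (E' x) * r powr (1 / s)"
    using \<open>0 < c\<close> by (simp add: field_simps)
  moreover have "r = r powr ((s - 1) / s) * r powr (1 / s)"
    using r \<open>1 < s\<close> by (simp add: powr_add[symmetric] add_divide_distrib[symmetric])
  ultimately have "c powr (1 / s) * r powr ((s - 1) / s) * r powr (1 / s)
      \<le> norm (E' x) * r powr (1 / s)"
    by (metis mult.assoc)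
  with r show ?thesis by (simp add: r_def)
qed simp

section \<open>Dictionary directions and the greedy step\<close>

lemma norming_dictionary_descent_direction:
  fixes D :: "'a::real_normed_vector set"
  assumes "norming (D \<inter> sphere 0 1)" and "balanced D"
  obtains C where "1 \<le> C"
    and "\<And>\<phi> :: 'a \<Rightarrow>\<^sub>L real. \<phi> \<noteq> 0 \<Longrightarrow> \<exists>z\<in>D. norm z = 1 \<and> blinfun_apply \<phi> z \<le> - norm \<phi> / C"
proof -
  obtain C where C: "0 < C" and bound: "\<And>\<phi> :: 'a \<Rightarrow>\<^sub>L real.
      ennreal (norm \<phi>) \<le> ennreal C * (SUP z\<in>D \<inter> sphere 0 1. ennreal \<bar>blinfun_apply \<phi> z\<bar>)"
    using assms(1) unfolding norming_def by blast
  \<comment> \<open>The supremum need not be attained, so a constant above \<open>C\<close> is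
    required; \<open>2 * C + 1\<close> is also at least 1. Balancedness supplies the sign. An empty
    dictionary sphere is refuted by the same estimate, its supremum being 0.\<close>
  have "\<exists>z\<in>D. norm z = 1 \<and> blinfun_apply \<phi> z \<le> - norm \<phi> / (2 * C + 1)" if "\<phi> \<noteq> 0" for \<phi> :: "'a \<Rightarrow>\<^sub>L real"
  proof (rule ccontr)
    assume none: "\<not> ?thesis"
    have "\<bar>blinfun_apply \<phi> z\<bar> \<le> norm \<phi> / (2 * C + 1)" if "z \<in> D \<inter> sphere 0 1" for z
    proof -
      have "- z \<in> D" using that assms(2) by (auto simp: balanced_def)
      with that none have "\<not> blinfun_apply \<phi> z \<le> - norm \<phi> / (2 * C + 1)"
        and "\<not> blinfun_apply \<phi> (- z) \<le> - norm \<phi> / (2 * C + 1)"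
        by auto
      then show ?thesis by (simp add: blinfun.minus_right)
    qed
    then have "(SUP z\<in>D \<inter> sphere 0 1. ennreal \<bar>blinfun_apply \<phi> z\<bar>) \<le> ennreal (norm \<phi> / (2 * C + 1))"
      by (intro SUP_least ennreal_leI) auto
    with bound[of \<phi>] have "ennreal (norm \<phi>) \<le> ennreal C * ennreal (norm \<phi> / (2 * C + 1))"
      by (meson mult_left_mono order_trans zero_le)
    also have "\<dots> = ennreal (C * (norm \<phi> / (2 * C + 1)))" using C by (intro ennreal_mult[symmetric]) auto
    finally have "norm \<phi> \<le> C * (norm \<phi> / (2 * C + 1))" using C by (simp add: ennreal_le_iff)
    then have "norm \<phi> * (C + 1) \<le> 0" using C by (simp add: field_simps)
    with C that show False by (simp add: mult_le_0_iff)
  qed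
  with C that[of "2 * C + 1"] show thesis by simp
qed

text \<open>\<open>L\<close> serves both as Hoelder constant and as gradient bound. The second role,
  with \<open>1 \<le> C\<close>, forces the trial step length to be at most 1, so the trial segment
  stays in the unit ball around \<open>x\<close> where the Hoelder estimate is available.\<close>

lemma greedy_decrease:
  fixes E :: "'a::real_normed_vector \<Rightarrow> real" and E' :: "'a \<Rightarrow> ('a \<Rightarrow>\<^sub>L real)"
  assumes deriv: "\<And>x. (E has_derivative blinfun_apply (E' x)) (at x)"
    and "0 < p" and "0 < L" and "1 \<le> C"
    and holder: "\<And>y. dist x y \<le> 1 \<Longrightarrow> norm (E' y - E' x) \<le> L * norm (y - x) powr p"
    and dir: "\<And>\<phi> :: 'a \<Rightarrow>\<^sub>L real. \<phi> \<noteq> 0 \<Longrightarrow> \<exists>z\<in>D. norm z = 1 \<and> blinfun_apply \<phi> z \<le> - norm \<phi> / C"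
    and "cone D" and "D \<noteq> {}" and greedy: "\<And>v. v \<in> D \<Longrightarrow> E x' \<le> E (x + v)"
    and "norm (E' x) \<le> L"
  shows "E x' \<le> E x - (2 * C * L) powr (- 1 / p) / (2 * C) * norm (E' x) powr (1 + 1 / p)"
proof (cases "E' x = 0")
  case True
  have "0 \<in> D" using \<open>cone D\<close> \<open>D \<noteq> {}\<close> by (metis cone_0 cone_contains_0)
  with greedy[of 0] True show ?thesis by simp
next
  case False
  define G where "G = norm (E' x)"
  have G: "0 < G" using False by (simp add: G_def)
  obtain z where z: "z \<in> D" "norm z = 1" "blinfun_apply (E' x) z \<le> - G / C"
    using dir[OF False] by (auto simp: G_def)
  \<comment> \<open>\<open>t\<close> makes the error term \<open>L * t powr (1 + p)\<close> half of the gain \<open>t * G / C\<close>.\<close>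
  define t where "t = (G / (2 * C * L)) powr (1 / p)"
  have t: "0 < t" "t powr p = G / (2 * C * L)"
    using G \<open>0 < p\<close> \<open>0 < L\<close> \<open>1 \<le> C\<close> by (simp_all add: t_def powr_powr)
  have "G \<le> 2 * C * L"
    using \<open>norm (E' x) \<le> L\<close> \<open>1 \<le> C\<close> \<open>0 < L\<close> mult_right_mono[of 1 "2 * C" L]
    unfolding G_def by linarith
  then have "G / (2 * C * L) \<le> 1" using \<open>0 < L\<close> \<open>1 \<le> C\<close> by (simp add: field_simps)
  then have t1: "t \<le> 1"
    using powr_mono2[of "1 / p" "G / (2 * C * L)" 1] G \<open>0 < p\<close> \<open>0 < L\<close> \<open>1 \<le> C\<close> by (simp add: t_def)
  have "t *\<^sub>R z \<in> D" using z(1) t(1) \<open>cone D\<close> by (simp add: cone_def)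
  from greedy[OF this] have "E x' \<le> E (x + t *\<^sub>R z)" .
  also have "\<dots> \<le> E x + blinfun_apply (E' x) (t *\<^sub>R z) + L * norm (t *\<^sub>R z) powr (1 + p)"
  proof (rule holder_gradient_upper_bound[OF deriv])
    fix y assume y: "y \<in> closed_segment x (x + t *\<^sub>R z)"
    have "dist x y \<le> dist x (x + t *\<^sub>R z)" using segment_bound1[OF y] by (simp add: dist_norm norm_minus_commute)
    also have "\<dots> \<le> 1" using z(2) t t1 by (simp add: dist_norm)
    finally show "norm (E' y - E' x) \<le> L * norm (y - x) powr p" by (rule holder)
  qed (use \<open>0 < p\<close> \<open>0 < L\<close> in auto)
  also have "\<dots> = E x + t * blinfun_apply (E' x) z + t * (L * t powr p)"
    using z(2) t(1) by (simp add: blinfun.scaleR_right powr_add)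
  also have "\<dots> \<le> E x + t * (- G / C) + t * (L * (G / (2 * C * L)))"
    unfolding t(2) using t(1) z(3) \<open>0 < L\<close> by (intro add_mono mult_left_mono) auto
  also have "\<dots> = E x - t * G / (2 * C)"
    using \<open>0 < L\<close> \<open>1 \<le> C\<close> by (simp add: field_simps)
  also have "t * G = (2 * C * L) powr (- 1 / p) * G powr (1 + 1 / p)"
    using G \<open>0 < L\<close> \<open>1 \<le> C\<close> by (simp add: t_def powr_divide powr_minus powr_add field_simps)
  finally show ?thesis by (simp add: G_def)
qed

text \<open>Since (A) is only local, a constant independent of \<open>m\<close> requires bounded
  iterates. These follow from monotone energies and uniform convexity around
  \<open>ustar\<close>.\<close>

lemma greedy_energy_recursion:
  fixes E :: "'a::real_normed_vector \<Rightarrow> real"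
    and E' :: "'a \<Rightarrow> ('a \<Rightarrow>\<^sub>L real)"
  assumes "0 < p" and "1 < s"
    and deriv: "\<And>x. (E has_derivative blinfun_apply (E' x)) (at x)"
    and A: "\<And>K. bounded K \<Longrightarrow>
              \<exists>L>0. \<forall>x\<in>K. \<forall>y\<in>K. norm (E' x - E' y) \<le> L * norm (x - y) powr p"
    and B: "\<exists>a>0. \<forall>x y. blinfun_apply (E' x - E' y) (x - y) \<ge> a * norm (x - y) powr s"
    and D: "balanced D" "cone D" "norming (D \<inter> sphere 0 1)"
    and min: "\<And>y. E ustar \<le> E y"
    and greedy: "greedy_sequence E D u"
  obtains \<kappa> where "0 < \<kappa>"
    and "\<And>m. E (u (Suc m)) - E ustar
        \<le> E (u m) - E ustar - \<kappa> * (E (u m) - E ustar) powr (1 + (s - 1 - p) / (s * p))"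
proof -
  obtain a where a: "0 < a"
    and mono: "\<And>x y. blinfun_apply (E' x - E' y) (x - y) \<ge> a * norm (x - y) powr s"
    using B by blast
  define c where "c = a / 2 powr s"
  have c: "0 < c" using a by (simp add: c_def)
  have low: "E y \<ge> E x + blinfun_apply (E' x) (y - x) + c * norm (y - x) powr s" for x y
    unfolding c_def using strongly_monotone_lower_bound[OF deriv mono] a by simp
  have grad0: "E' ustar = 0" by (rule minimizer_gradient_zero[OF deriv min])
  have D_step: "u (Suc m) - u m \<in> D" for m
    using greedy unfolding greedy_sequence_def by (metis diff_Suc_1 le_add1 plus_1_eq_Suc)
  have opt: "E (u (Suc m)) \<le> E (u m + v)" if "v \<in> D" for m v
    using greedy that unfolding greedy_sequence_def by (metis diff_Suc_1 le_add1 plus_1_eq_Suc)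
  have "D \<noteq> {}" using D_step by blast
  then have "0 \<in> D" using D(2) by (metis cone_0 cone_contains_0)
  then have "E (u (Suc m)) \<le> E (u m)" for m using opt[of 0 m] by simp
  then have "decseq (\<lambda>m. E (u m))" by (simp add: decseq_Suc_iff)
  then have E_le: "E (u m) \<le> E (u 0)" for m by (rule decseqD) simp
  \<comment> \<open>Solves c R^s = E(u 0) - E(ustar): the lower bound at \<open>ustar\<close>, where
    the gradient vanishes, confines the sublevel set of \<open>u 0\<close> to this radius.\<close>
  define R where "R = ((E (u 0) - E ustar) / c) powr (1 / s)"
  have R: "norm (u m - ustar) \<le> R" for m
  proof -
    have "norm (u m - ustar) powr s \<le> (E (u 0) - E ustar) / c"
      using low[of ustar "u m"] grad0 E_le[of m] c by (simp add: field_simps)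
    then have "(norm (u m - ustar) powr s) powr (1 / s) \<le> R"
      unfolding R_def using \<open>1 < s\<close> by (intro powr_mono2) auto
    then show ?thesis using \<open>1 < s\<close> by (simp add: powr_powr)
  qed
  \<comment> \<open>The extra 1 in the radius makes room for trial steps of length at most
    1.\<close>
  obtain L0 where L0: "0 < L0" and holder0: "\<And>x y. x \<in> cball ustar (R + 1) \<Longrightarrow>
      y \<in> cball ustar (R + 1) \<Longrightarrow> norm (E' x - E' y) \<le> L0 * norm (x - y) powr p"
    using A[OF bounded_cball] by meson
  have R0: "0 \<le> R" by (simp add: R_def)
  \<comment> \<open>The maximum gives \<open>L\<close> both roles: it dominates the Hoelder constant
    \<open>L0\<close>, and it dominates \<open>L0 * R powr p\<close>, which bounds the gradients at
    the iterates because \<open>E' ustar = 0\<close>.\<close>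
  define L where "L = L0 * max 1 (R powr p)"
  have L: "0 < L" "L0 \<le> L" "L0 * R powr p \<le> L"
    using L0 by (auto simp: L_def mult_le_cancel_left1)
  obtain C where C: "1 \<le> C"
    and dir: "\<And>\<phi> :: 'a \<Rightarrow>\<^sub>L real. \<phi> \<noteq> 0 \<Longrightarrow> \<exists>z\<in>D. norm z = 1 \<and> blinfun_apply \<phi> z \<le> - norm \<phi> / C"
    using norming_dictionary_descent_direction[OF D(3,1)] by blast
  define \<mu> where "\<mu> = (2 * C * L) powr (- 1 / p) / (2 * C)"
  have \<mu>: "0 < \<mu>" using C L by (simp add: \<mu>_def)
  have step: "E (u (Suc m)) \<le> E (u m) - \<mu> * norm (E' (u m)) powr (1 + 1 / p)" for m
    unfolding \<mu>_def
  proof (rule greedy_decrease[OF deriv \<open>0 < p\<close> \<open>0 < L\<close> \<open>1 \<le> C\<close> _ dir D(2) \<open>D \<noteq> {}\<close> opt])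
    fix y assume y: "dist (u m) y \<le> 1"
    have "dist ustar (u m) \<le> R" using R[of m] by (simp add: dist_norm norm_minus_commute)
    with y have "y \<in> cball ustar (R + 1)" "u m \<in> cball ustar (R + 1)"
      using dist_triangle[of ustar y "u m"] by auto
    from holder0[OF this] have "norm (E' y - E' (u m)) \<le> L0 * norm (y - u m) powr p" .
    also have "\<dots> \<le> L * norm (y - u m) powr p" using L by (intro mult_right_mono) auto
    finally show "norm (E' y - E' (u m)) \<le> L * norm (y - u m) powr p" .
  next
    have "norm (E' (u m) - E' ustar) \<le> L0 * norm (u m - ustar) powr p"
      using R[of m] R0 by (intro holder0) (auto simp: dist_norm norm_minus_commute)
    also have "\<dots> \<le> L0 * R powr p"
      using R[of m] L0 \<open>0 < p\<close> by (intro mult_left_mono powr_mono2) auto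
    finally show "norm (E' (u m)) \<le> L" using grad0 L by simp
  qed
  define \<kappa> where "\<kappa> = \<mu> * (c powr (1 / s)) powr (1 + 1 / p)"
  show thesis
  proof (rule that)
    show "0 < \<kappa>" using \<mu> c by (simp add: \<kappa>_def)
    fix m
    define r where "r = E (u m) - E ustar"
    have exponent: "(s - 1) / s * (1 + 1 / p) = 1 + (s - 1 - p) / (s * p)"
      using \<open>0 < p\<close> \<open>1 < s\<close> by (simp add: field_simps)
    have "(c powr (1 / s) * r powr ((s - 1) / s)) powr (1 + 1 / p) \<le> norm (E' (u m)) powr (1 + 1 / p)"
      unfolding r_def using gap_le_gradient[OF low c \<open>1 < s\<close> grad0 min] \<open>0 < p\<close>
      by (intro powr_mono2) auto
    also have "(c powr (1 / s) * r powr ((s - 1) / s)) powr (1 + 1 / p)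
        = (c powr (1 / s)) powr (1 + 1 / p) * r powr (1 + (s - 1 - p) / (s * p))"
      by (simp only: powr_mult powr_powr[of r] exponent)
    finally have "\<kappa> * r powr (1 + (s - 1 - p) / (s * p)) \<le> \<mu> * norm (E' (u m)) powr (1 + 1 / p)"
      using \<mu> by (simp add: \<kappa>_def mult.assoc)
    with step[of m] show "E (u (Suc m)) - E ustar
        \<le> E (u m) - E ustar - \<kappa> * (E (u m) - E ustar) powr (1 + (s - 1 - p) / (s * p))"
      by (simp add: r_def)
  qed
qed

section \<open>Convergence rates of greedy sequences\<close>

theorem theorem3p8:
  fixes E :: "'a::banach \<Rightarrow> real"
    and E' :: "'a \<Rightarrow> ('a \<Rightarrow>\<^sub>L real)"
    and p s :: real
    and D :: "'a set"
    and ustar :: 'a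
    and u :: "nat \<Rightarrow> 'a"
  assumes "0 < p" and "p \<le> 1" and "1 < s"
    and "reflexive_space TYPE('a)"
    and "\<And>x. (E has_derivative blinfun_apply (E' x)) (at x)"
    and A: "\<And>K. bounded K \<Longrightarrow>
              \<exists>L>0. \<forall>x\<in>K. \<forall>y\<in>K. norm (E' x - E' y) \<le> L * norm (x - y) powr p"
    and B: "\<exists>a>0. \<forall>x y. blinfun_apply (E' x - E' y) (x - y) \<ge> a * norm (x - y) powr s"
    and "radial_dictionary D"
    and "norming (D \<inter> sphere 0 1)"
    and "is_unique_minimizer E ustar"
    and "greedy_sequence E D u"
  shows "(s > p + 1 \<longrightarrow>
            (\<lambda>m. E (u m) - E ustar) \<in> O(\<lambda>m. real m powr (- (p / (s - 1 - p))))) \<and>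
         (s = p + 1 \<longrightarrow>
            (\<forall>k::nat. (\<lambda>m. E (u m) - E ustar) \<in> O(\<lambda>m. real m powr (- real k))) \<and>
            (\<exists>C \<alpha>. C > 0 \<and> 0 \<le> \<alpha> \<and> \<alpha> < 1 \<and> (\<forall>m. E (u m) - E ustar \<le> C * \<alpha> ^ m)))"
proof -
  define r where "r m = E (u m) - E ustar" for m
  have min: "E ustar \<le> E y" for y
    using \<open>is_unique_minimizer E ustar\<close> by (simp add: is_unique_minimizer_def)
  have nonneg: "0 \<le> r m" for m by (simp add: r_def min)
  have "balanced D" "cone D" using \<open>radial_dictionary D\<close> by (simp_all add: radial_dictionary_def)
  then obtain \<kappa> where "0 < \<kappa>"
    and rec: "\<And>m. r (Suc m) \<le> r m - \<kappa> * r m powr (1 + (s - 1 - p) / (s * p))"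
    using greedy_energy_recursion[OF assms(1,3,5) A B _ _ assms(9) min assms(11)]
    unfolding r_def by metis
  have "r \<in> O(\<lambda>m. real m powr (- (p / (s - 1 - p))))" if "s > p + 1"
  proof -
    define \<gamma> where "\<gamma> = (s - 1 - p) / (s * p)"
    have "0 < \<gamma>" using that \<open>0 < p\<close> \<open>1 < s\<close> by (simp add: \<gamma>_def)
    have "r \<in> O(\<lambda>m. real m powr (- 1 / \<gamma>))"
      using power_recursion_decay[OF nonneg \<open>0 < \<kappa>\<close> \<open>0 < \<gamma>\<close>] rec by (simp add: \<gamma>_def)
    also have "(\<lambda>m. real m powr (- 1 / \<gamma>)) \<in> O(\<lambda>m. real m powr (- (p / (s - 1 - p))))"
    proof (intro bigoI[where c = 1] eventually_sequentiallyI[of 1])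
      fix m :: nat assume "1 \<le> m"
      \<comment> \<open>Here 1 / \<gamma> = s p / (s - 1 - p), and s > 1. Comparing the powers needs
        a base of at least 1, hence \<open>1 \<le> m\<close>.\<close>
      have "- 1 / \<gamma> \<le> - (p / (s - 1 - p))"
        using that \<open>0 < p\<close> \<open>1 < s\<close> by (simp add: \<gamma>_def divide_right_mono)
      with \<open>1 \<le> m\<close> show "norm (real m powr (- 1 / \<gamma>)) \<le> 1 * norm (real m powr (- (p / (s - 1 - p))))"
        by (simp add: powr_mono)
    qed
    finally show ?thesis .
  qed
  moreover have "(\<forall>k::nat. r \<in> O(\<lambda>m. real m powr (- real k))) \<and>
      (\<exists>C \<alpha>. C > 0 \<and> 0 \<le> \<alpha> \<and> \<alpha> < 1 \<and> (\<forall>m. r m \<le> C * \<alpha> ^ m))" if "s = p + 1"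
  proof -
    \<comment> \<open>The 1/2 keeps \<open>\<alpha>\<close> positive even if
      \<open>\<kappa> \<ge> 1\<close>, and the added 1 keeps \<open>C\<close> positive even if
      \<open>r 0 = 0\<close>.\<close>
    define C \<alpha> where "C = r 0 + 1" and "\<alpha> = max (1 / 2) (1 - \<kappa>)"
    have \<alpha>: "0 < \<alpha>" "\<alpha> < 1" and "0 < C"
      using \<open>0 < \<kappa>\<close> nonneg[of 0] by (auto simp: \<alpha>_def C_def)
    have bound: "r m \<le> C * \<alpha> ^ m" for m
    proof (induction m)
      case (Suc m)
      \<comment> \<open>For s = p + 1 the exponent in the recursion is 1, so the decrease is linear
        in \<open>r m\<close>.\<close>
      have "r (Suc m) \<le> (1 - \<kappa>) * r m"
        using rec[of m] nonneg[of m] that by (simp add: algebra_simps)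
      also have "\<dots> \<le> \<alpha> * r m" using nonneg by (intro mult_right_mono) (auto simp: \<alpha>_def)
      also have "\<dots> \<le> \<alpha> * (C * \<alpha> ^ m)" using Suc \<alpha> by (intro mult_left_mono) auto
      finally show ?case by (simp add: mult_ac)
    qed (simp add: C_def)
    show ?thesis
      using geometric_bound_bigo_powr[OF nonneg bound \<open>0 < C\<close> \<alpha>] bound \<open>0 < C\<close> \<alpha>
      by (intro conjI allI exI[of _ C] exI[of _ \<alpha>]) auto
  qed
  ultimately show ?thesis unfolding r_def by blast
qed

end
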